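(* Let $X$ be a point-transitive interval space and $a,d\in X$. If the binary relation $\langle[a,d],\cdot,\cdot\rangle$ is antisymmetric on $X\setminus[a,d]$, then for all $b,c\in X$, ($\langle a,b,c\rangle$ and $b\neq c$ and $\langle b,c,d\rangle$) implies $\langle a,b,d\rangle$.
   Context: An interval space is a set $X$ with a ternary relation $\langle\cdot,\cdot,\cdot\rangle$ such that: $\langle x,x,a\rangle$ and $\langle a,x,x\rangle$ for all $a,x\in X$; $\langle x,a,z\rangle\Rightarrow\langle z,a,x\rangle$; and $\langle x,y,x\rangle$ implies $y=x$. It is point-transitive iff for each $a\in X$ the binary relation $\langle a,\cdot,\cdot\rangle$ is transitive, i.e. $\langle a,x,y\rangle$ and $\langle a,y,z\rangle$ imply $\langle a,x,z\rangle$. For $A\subseteq X$ and $b,c\in X$, $\langle A,b,c\rangle$ means there is $a\in A$ with $\langle a,b,c\rangle$. For $a,d\in X$, $[a,d]=\{x\in X:\langle a,x,d\rangle\}$. *)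

theory Defs
  imports Main
begin

text \<open>The ternary relation is a predicate on the ambient type; only its values on the carrier
  \<open>X\<close> are constrained or used. \<open>B a x d\<close> stands for \<open>\<langle>a,x,d\<rangle>\<close>.\<close>

locale interval_space =
  fixes X :: "'a set" and B :: "'a \<Rightarrow> 'a \<Rightarrow> 'a \<Rightarrow> bool"
  assumes left_refl: "\<lbrakk>a \<in> X; x \<in> X\<rbrakk> \<Longrightarrow> B x x a"
    and right_refl: "\<lbrakk>a \<in> X; x \<in> X\<rbrakk> \<Longrightarrow> B a x x"
    and symmetric: "\<lbrakk>x \<in> X; a \<in> X; z \<in> X; B x a z\<rbrakk> \<Longrightarrow> B z a x"
    and degenerate: "\<lbrakk>x \<in> X; y \<in> X; B x y x\<rbrakk> \<Longrightarrow> y = x"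

locale point_transitive_interval_space = interval_space +
  assumes point_transitive: "a \<in> X \<Longrightarrow> transp_on X (B a)"

definition interval :: "'a set \<Rightarrow> ('a \<Rightarrow> 'a \<Rightarrow> 'a \<Rightarrow> bool) \<Rightarrow> 'a \<Rightarrow> 'a \<Rightarrow> 'a set" where
  "interval X B a d = {x \<in> X. B a x d}"

definition set_between :: "('a \<Rightarrow> 'a \<Rightarrow> 'a \<Rightarrow> bool) \<Rightarrow> 'a set \<Rightarrow> 'a \<Rightarrow> 'a \<Rightarrow> bool" where
  "set_between B A b c \<longleftrightarrow> (\<exists>a\<in>A. B a b c)"

end

theory Submission
  imports Defs
begin

text \<open>If \<open>b\<close> lay outside \<open>[a,d]\<close>, then so would \<open>c\<close>,
  and the two endpoints would order the pair in opposite ways: seen from \<open>a\<close>,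
  \<open>b\<close> comes before \<open>c\<close>; seen from \<open>d\<close>, \<open>c\<close> comes
  before \<open>b\<close>. Both endpoints belong to \<open>[a,d]\<close>, so antisymmetry outside
  the interval forces \<open>b = c\<close>, a contradiction.\<close>

theorem proposition3p1:
  fixes X :: "'a set" and B :: "'a \<Rightarrow> 'a \<Rightarrow> 'a \<Rightarrow> bool" and a d :: 'a
  assumes "point_transitive_interval_space X B"
    and "a \<in> X" and "d \<in> X"
    and "antisymp_on (X - interval X B a d) (set_between B (interval X B a d))"
  shows "\<forall>b\<in>X. \<forall>c\<in>X. B a b c \<and> b \<noteq> c \<and> B b c d \<longrightarrow> B a b d"
proof (intro ballI impI, elim conjE, rule ccontr)
  interpret point_transitive_interval_space X B by fact
  fix b c
  assume "b \<in> X" "c \<in> X" "B a b c" "b \<noteq> c" "B b c d" "\<not> B a b d"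
  \<comment> \<open>The endpoints are the witnesses for the two opposite instances of
    \<open>set_between\<close>: \<open>a\<close> for \<open>b\<close>, \<open>c\<close> and
    \<open>d\<close> for \<open>c\<close>, \<open>b\<close>.\<close>
  have "a \<in> interval X B a d" "d \<in> interval X B a d"
    using \<open>a \<in> X\<close> \<open>d \<in> X\<close> left_refl right_refl by (auto simp: interval_def)
  moreover have "B d c b"
    using symmetric \<open>b \<in> X\<close> \<open>c \<in> X\<close> \<open>d \<in> X\<close> \<open>B b c d\<close> by blast
  ultimately have "set_between B (interval X B a d) b c" "set_between B (interval X B a d) c b"
    using \<open>B a b c\<close> by (auto simp: set_between_def)
  \<comment> \<open>Otherwise transitivity of \<open>B a\<close> would chain \<open>B a b c\<close>
    with \<open>B a c d\<close> into \<open>B a b d\<close>. This puts \<open>c\<close> in the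
    region where antisymmetry is available.\<close>
  moreover have "\<not> B a c d"
    using transp_onD[OF point_transitive[OF \<open>a \<in> X\<close>] \<open>b \<in> X\<close> \<open>c \<in> X\<close> \<open>d \<in> X\<close> \<open>B a b c\<close>]
      \<open>\<not> B a b d\<close> by blast
  then have "b \<in> X - interval X B a d" "c \<in> X - interval X B a d"
    using \<open>b \<in> X\<close> \<open>c \<in> X\<close> \<open>\<not> B a b d\<close> by (auto simp: interval_def)
  ultimately have "b = c"
    using antisymp_onD[OF assms(4)] by blast
  with \<open>b \<noteq> c\<close> show False ..
qed

end
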